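(* Let $g=g_1+g_2$ on $\mathbb{R}^n$, where $g_1:\mathbb{R}^n\to\mathbb{R}\cup\{+\infty\}$ is a proper, closed and $\mu_g$-strongly convex function ($\mu_g>0$) and $g_2:\mathbb{R}^n\to\mathbb{R}$ is convex with $L_{g_2}$-Lipschitz continuous gradient. Let $B\in\mathbb{R}^{p\times n}$, $b\in\mathbb{R}^p$, and suppose the set $\Omega$ of saddle points of $\mathcal{L}(y,\lambda)=g(y)+\langle\lambda,By-b\rangle$ is nonempty. Let $\{y_k\}_{k\ge1}$ be generated by Algorithm 8 (described in the context) with parameters $\beta,\gamma>0$, and let $(y^*,\lambda^* )\in\Omega$. Assume $\beta\le\frac{t_1^2}{L_{g_2}+t_1^2\gamma\|B\|^2}$ and that $\{t_k\}_{k\ge1}\subseteq[1,+\infty)$ is a nondecreasing sequence satisfying, for all $k\ge1$, $$t_{k+1}^2\le t_k^2+t_{k+1}\quad\text{and}\quad t_{k+1}^2\le t_k^2+\beta\mu_gt_k.$$ Then for all $k\ge1$: $$\|By_k-b\|\le\frac{C_4}{t_k^2},\qquad |g(y_k)-g(y^* )|\le\frac{\mathcal{E}_1+C_4\|\lambda^*\|}{t_k^2},$$ where $$\mathcal{E}_1=t_1^2\big(g(y_1)-g(y^* )+\langle\lambda^*,By_1-b\rangle\big)+\frac{t_2^2}{2\beta}\|y_1-y^*\|^2+\frac{1}{2\gamma}\|\lambda_1-\lambda^*\|^2,$$ $$C_4=3t_1^2\|By_1-b\|+\frac{2\|\lambda_1-\lambda^*\|+2\sqrt{2\gamma\mathc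al{E}_1}}{\gamma}.$$
   Context: Norms are Euclidean (operator norm for matrices). $dom(F)=\{x: F(x)<+\infty\}$; $F$ is proper if $dom(F)\ne\emptyset$; $F$ is closed if $F(x)\le\liminf_{y\to x}F(y)$ for all $x$ and $dom(F)$ is closed. $1/0$ is read as $+\infty$ in step-size bounds. $\mu_g$-strong convexity of $g_1$ means $g_1(y_2)-g_1(y_1)-\langle\xi,y_2-y_1\rangle\ge\frac{\mu_g}{2}\|y_2-y_1\|^2$ for all $y_1,y_2$ and $\xi\in\partial g_1(y_1)$. A saddle point is a pair $(y^*,\lambda^* )$ with $\mathcal{L}(y^*,\lambda)\le\mathcal{L}(y^*,\lambda^* )\le\mathcal{L}(y,\lambda^* )$ for all $(y,\lambda)$. The proximal operator is $\mathbf{Prox}_{s,h}(z)=\arg\min_x h(x)+\frac{1}{2s}\|x-z\|^2$. Algorithm 8 (for $\min g(y)$ s.t. $By=b$). Initialize $y_1=y_0=v_1\in dom(g)$, $\lambda_1\in\mathbb{R}^p$. For $k=1,2,\dots$: - $\bar y_k=y_k+\frac{t_k-1}{t_{k+1}}(y_k-y_{k-1})$; - $\bar\lambda_{k+1}=\lambda_k+\gamma t_{k+1}(Bv_k-b)$; - $v_{k+1}=\mathbf{Prox}_{\frac{\beta}{t_{k+1}},g_1}\big(v_k-\frac{\beta}{t_{k+1}}(B^T\bar\lambda_{k+1}+\nabla g_2(\bar y_k))\big)$; - $y_{k+1}=\frac{1}{t_{k+1}}v_{k+1}+\frac{t_{k+1}-1}{t_{k+1}}y_k$; - $\lambda_{k+1}=\lambda_k+\gamma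 t_{k+1}(Bv_{k+1}-b)$. *)

theory Defs
  imports "HOL-Analysis.Analysis"
begin

definition effective_domain :: "('a \<Rightarrow> ereal) \<Rightarrow> 'a set" where
  "effective_domain F = {x. F x < \<infinity>}"

text \<open>Functions into \<open>\<real> \<union> {+\<infinity>}\<close> are rendered as \<^typ>\<open>ereal\<close>-valued functions;
  \<open>proper_fun\<close> therefore also excludes the value \<open>-\<infinity>\<close>.\<close>

definition proper_fun :: "('a \<Rightarrow> ereal) \<Rightarrow> bool" where
  "proper_fun F \<longleftrightarrow> (\<forall>x. F x \<noteq> -\<infinity>) \<and> effective_domain F \<noteq> {}"

text \<open>Besides lower semicontinuity, closedness of the domain is required here; this is more
  than closedness of the epigraph.\<close>

definition closed_fun :: "('a::topological_space \<Rightarrow> ereal) \<Rightarrow> bool" where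
  "closed_fun F \<longleftrightarrow> (\<forall>x. F x \<le> Liminf (at x) F) \<and> closed (effective_domain F)"

definition convex_fun :: "('a::real_vector \<Rightarrow> ereal) \<Rightarrow> bool" where
  "convex_fun F \<longleftrightarrow>
     (\<forall>x y. \<forall>u\<in>{0..1}. F ((1 - u) *\<^sub>R x + u *\<^sub>R y) \<le> ereal (1 - u) * F x + ereal u * F y)"

definition subdifferential :: "('a::real_inner \<Rightarrow> ereal) \<Rightarrow> 'a \<Rightarrow> 'a set" where
  "subdifferential F x =
     {\<xi>. x \<in> effective_domain F \<and> (\<forall>z. F x + ereal (\<xi> \<bullet> (z - x)) \<le> F z)}"

text \<open>Convexity is stated separately: the subgradient inequality alone would hold vacuously for
  a function without subgradients.\<close>

definition strongly_convex_fun :: "real \<Rightarrow> ('a::real_inner \<Rightarrow> ereal) \<Rightarrow> bool" where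
  "strongly_convex_fun \<mu> F \<longleftrightarrow> convex_fun F \<and>
     (\<forall>y1 y2. \<forall>\<xi>\<in>subdifferential F y1.
        F y2 - F y1 - ereal (\<xi> \<bullet> (y2 - y1)) \<ge> ereal (\<mu> / 2 * (norm (y2 - y1))\<^sup>2))"

definition prox :: "real \<Rightarrow> ('a::real_normed_vector \<Rightarrow> ereal) \<Rightarrow> 'a \<Rightarrow> 'a" where
  "prox s h z = arg_min (\<lambda>x. h x + ereal (1 / (2 * s) * (norm (x - z))\<^sup>2)) (\<lambda>_. True)"

definition lagrangian ::
  "(real^'n \<Rightarrow> ereal) \<Rightarrow> real^'n^'p \<Rightarrow> real^'p \<Rightarrow> real^'n \<Rightarrow> real^'p \<Rightarrow> ereal" where
  "lagrangian g B b y l = g y + ereal (l \<bullet> (B *v y - b))"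

definition saddle_points ::
  "(real^'n \<Rightarrow> ereal) \<Rightarrow> real^'n^'p \<Rightarrow> real^'p \<Rightarrow> ((real^'n) \<times> (real^'p)) set" where
  "saddle_points g B b = {(ys, ls). \<forall>y l.
     lagrangian g B b ys l \<le> lagrangian g B b ys ls \<and>
     lagrangian g B b ys ls \<le> lagrangian g B b y ls}"

text \<open>\<open>G2\<close> is the gradient of \<open>g2\<close>, and \<open>y\<close>, \<open>v\<close>, \<open>l\<close> are the sequences generated by the
  accelerated primal-dual scheme. The values \<open>v 0\<close>, \<open>l 0\<close>, \<open>t 0\<close> play no role.\<close>

definition accelerated_primal_dual ::
  "(real^'n \<Rightarrow> ereal) \<Rightarrow> (real^'n \<Rightarrow> real) \<Rightarrow> (real^'n \<Rightarrow> real^'n) \<Rightarrow> real^'n^'p \<Rightarrow> real^'p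
   \<Rightarrow> real \<Rightarrow> real \<Rightarrow> (nat \<Rightarrow> real)
   \<Rightarrow> (nat \<Rightarrow> real^'n) \<Rightarrow> (nat \<Rightarrow> real^'n) \<Rightarrow> (nat \<Rightarrow> real^'p) \<Rightarrow> bool" where
  "accelerated_primal_dual g1 g2 G2 B b \<beta> \<gamma> t y v l \<longleftrightarrow>
     y 1 = y 0 \<and> y 0 = v 1 \<and> v 1 \<in> effective_domain (\<lambda>x. g1 x + ereal (g2 x)) \<and>
     (\<forall>k\<ge>1.
        let ybar = y k + ((t k - 1) / t (k + 1)) *\<^sub>R (y k - y (k - 1));
            lbar = l k + (\<gamma> * t (k + 1)) *\<^sub>R (B *v v k - b)
        in v (k + 1) = prox (\<beta> / t (k + 1)) g1
                         (v k - (\<beta> / t (k + 1)) *\<^sub>R (transpose B *v lbar + G2 ybar)) \<and>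
           y (k + 1) = (1 / t (k + 1)) *\<^sub>R v (k + 1) + ((t (k + 1) - 1) / t (k + 1)) *\<^sub>R y k \<and>
           l (k + 1) = l k + (\<gamma> * t (k + 1)) *\<^sub>R (B *v v (k + 1) - b))"

end

theory Submission
  imports Defs
begin

text \<open>
  The energy
  \<open>E k = (t k)\<^sup>2 (\<L>(y k, ls) - \<L>(ys, ls)) + (t (k+1))\<^sup>2 / (2 \<beta>) \<parallel>v k - ys\<parallel>\<^sup>2 + \<parallel>l k - ls\<parallel>\<^sup>2 / (2 \<gamma>)\<close>
  is nonincreasing: the optimality condition of the proximal step is a subgradient inequality for
  \<open>g1\<close> at \<open>v (k+1)\<close>, the extrapolation makes \<open>y (k+1) - ybar\<close> equal to \<open>(v (k+1) - v k) / t (k+1)\<close>,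
  and the step-size bound absorbs the errors of the linearisation of \<open>g2\<close> and of the predicted
  multiplier. So the Lagrangian gap is \<open>O(1 / (t k)\<^sup>2)\<close> and the multipliers stay bounded.
  Summing the multiplier updates bounds \<open>a k + (\<Sum>i<k. c i a i)\<close> with
  \<open>a k = (t k)\<^sup>2 (B (y k) - b)\<close> and \<open>c i \<in> [0, 1]\<close>. The partial sums are then convex combinations
  of bounded vectors, so that \<open>a\<close> itself is bounded, and the Cauchy--Schwarz inequality turns the
  Lagrangian gap into a bound on the objective.
\<close>


section \<open>Lower semicontinuity and the proximal operator\<close>

text \<open>Without a minimiser, \<open>K\<close> is covered by the open sets where \<open>F\<close>
  exceeds some \<open>c\<close> that itself exceeds a value of \<open>F\<close> on \<open>K\<close>.
  The least \<open>c\<close> of a finite subcover still exceeds some \<open>F z\<close> with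
  \<open>z\<close> in \<open>K\<close>, and such a \<open>z\<close> lies in no set of the
  subcover.\<close>

lemma lsc_attains_inf:
  fixes F :: "'a::topological_space \<Rightarrow> ereal"
  assumes K: "compact K" "K \<noteq> {}"
    and lsc: "\<And>c. open {x. ereal c < F x}"
  obtains x where "x \<in> K" "\<And>z. z \<in> K \<Longrightarrow> F x \<le> F z"
proof -
  have "\<exists>x\<in>K. \<forall>z\<in>K. F x \<le> F z"
  proof (rule ccontr)
    assume "\<not> ?thesis"
    then have *: "\<forall>x\<in>K. \<exists>z\<in>K. F z < F x"
      by (auto simp: not_le)
    define T where "T = {c. \<exists>z\<in>K. F z < ereal c}"
    have cover: "K \<subseteq> (\<Union>c\<in>T. {x. ereal c < F x})"
    proof
      fix x assume "x \<in> K"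
      with * obtain z where "z \<in> K" "F z < F x" by blast
      then obtain c where "F z < ereal c" "ereal c < F x"
        using ereal_dense2 by blast
      then show "x \<in> (\<Union>c\<in>T. {x. ereal c < F x})"
        using \<open>z \<in> K\<close> by (auto simp: T_def)
    qed
    obtain T' where T': "T' \<subseteq> T" "finite T'" "K \<subseteq> (\<Union>c\<in>T'. {x. ereal c < F x})"
      using compactE_image[OF K(1) lsc cover] by blast
    with K(2) have "T' \<noteq> {}" by auto
    then have "Min T' \<in> T" using T' Min_in by blast
    then obtain z where z: "z \<in> K" "F z < ereal (Min T')"
      by (auto simp: T_def)
    then obtain c where "c \<in> T'" "ereal c < F z" using T'(3) by auto
    moreover have "Min T' \<le> c" using \<open>c \<in> T'\<close> T'(2) by simp
    ultimately show False
      using z(2) by (meson ereal_less_eq(3) less_le_trans less_asym)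
  qed
  then show ?thesis using that by blast
qed

lemma closed_fun_imp_open_superlevel:
  assumes "closed_fun F"
  shows "open {x. ereal c < F x}"
proof (subst open_subopen, intro ballI)
  fix x assume "x \<in> {x. ereal c < F x}"
  then have x: "ereal c < F x" by simp
  then have "\<forall>\<^sub>F y in at x. ereal c < F y"
    using assms unfolding closed_fun_def le_Liminf_iff by blast
  then obtain S where "open S" "x \<in> S" "\<forall>y\<in>S. y \<noteq> x \<longrightarrow> ereal c < F y"
    unfolding eventually_at_topological by auto
  \<comment> \<open>\<open>at x\<close> leaves out \<open>x\<close> itself; the assumption on
    \<open>F x\<close> puts it back.\<close>
  then show "\<exists>T. open T \<and> x \<in> T \<and> T \<subseteq> {x. ereal c < F x}"
    using x by (intro exI[of _ S]) auto
qed

text \<open>A real number \<open>r\<close> between \<open>c - q x\<close> and \<open>F x\<close>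
  separates the two functions, so the set is a union of intersections of open sets.\<close>

lemma open_superlevel_add_continuous:
  fixes F :: "'a::topological_space \<Rightarrow> ereal" and q :: "'a \<Rightarrow> real"
  assumes lsc: "\<And>c. open {x. ereal c < F x}" and q: "continuous_on UNIV q"
  shows "open {x. ereal c < F x + ereal (q x)}"
proof -
  have "ereal c < F x + ereal (q x) \<longleftrightarrow> (\<exists>r. ereal r < F x \<and> c - q x < r)" for x
  proof -
    have "ereal c < F x + ereal (q x) \<longleftrightarrow> ereal (c - q x) < F x"
      by (cases "F x") auto
    also have "\<dots> \<longleftrightarrow> (\<exists>r. ereal r < F x \<and> c - q x < r)"
    proof
      assume "ereal (c - q x) < F x"
      then show "\<exists>r. ereal r < F x \<and> c - q x < r"
        using ereal_dense2[of "ereal (c - q x)" "F x"] by auto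
    next
      assume "\<exists>r. ereal r < F x \<and> c - q x < r"
      then show "ereal (c - q x) < F x"
        by (meson ereal_less(2) less_ereal.simps(1) less_trans)
    qed
    finally show ?thesis .
  qed
  then have "{x. ereal c < F x + ereal (q x)} = (\<Union>r. {x. ereal r < F x} \<inter> {x. c - q x < r})"
    by auto
  moreover have "open {x. c - q x < r}" for r
    using q by (intro open_Collect_less continuous_intros) auto
  ultimately show ?thesis using lsc by (simp add: open_UN open_Int)
qed

lemma proper_fun_finite:
  assumes "proper_fun F" "x \<in> effective_domain F"
  obtains a where "F x = ereal a"
  using assms by (cases "F x") (auto simp: proper_fun_def effective_domain_def)

text \<open>Instead of an affine minorant: a lower bound on the unit ball around a point of the domain
  propagates outwards by convexity, with at most linear decay.\<close>

lemma prox_is_arg_min: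
  fixes F :: "'a::euclidean_space \<Rightarrow> ereal"
  assumes F: "proper_fun F" "closed_fun F" "convex_fun F" and s: "s > 0"
  shows "F (prox s F w) + ereal (1 / (2 * s) * (norm (prox s F w - w))\<^sup>2)
           \<le> F z + ereal (1 / (2 * s) * (norm (z - w))\<^sup>2)"
proof -
  define \<phi> where "\<phi> = (\<lambda>x. F x + ereal (1 / (2 * s) * (norm (x - w))\<^sup>2))"
  have lsc: "open {x. ereal c < F x}" for c
    using F(2) by (rule closed_fun_imp_open_superlevel)
  have lsc\<phi>: "open {x. ereal c < \<phi> x}" for c
    unfolding \<phi>_def by (intro open_superlevel_add_continuous lsc continuous_intros)
  obtain x0 a where a: "F x0 = ereal a"
    using F(1) proper_fun_finite unfolding proper_fun_def by (metis equals0I)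
  obtain x1 where x1: "x1 \<in> cball x0 1" "\<And>z. z \<in> cball x0 1 \<Longrightarrow> F x1 \<le> F z"
    using lsc_attains_inf[of "cball x0 1" F] lsc by auto
  have "F x1 \<le> ereal a" using x1(2)[of x0] a by simp
  then obtain m where m: "F x1 = ereal m"
    using F(1) by (cases "F x1") (auto simp: proper_fun_def)
  have "m \<le> a" using \<open>F x1 \<le> ereal a\<close> m by simp
  have minorant: "ereal (a - norm (x - x0) * (a - m)) \<le> F x" if "1 \<le> norm (x - x0)" for x
  proof (cases "F x")
    case (real r)
    define d where "d = norm (x - x0)"
    have d: "d \<ge> 1" using that by (simp add: d_def)
    have "(1 - 1/d) *\<^sub>R x0 + (1/d) *\<^sub>R x = x0 + (1/d) *\<^sub>R (x - x0)"
      by (simp add: algebra_simps)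
    moreover have "x0 + (1/d) *\<^sub>R (x - x0) \<in> cball x0 1"
      using d by (simp add: dist_norm d_def)
    ultimately have "ereal m \<le> F ((1 - 1/d) *\<^sub>R x0 + (1/d) *\<^sub>R x)"
      using x1(2) m by simp
    also have "\<dots> \<le> ereal (1 - 1/d) * F x0 + ereal (1/d) * F x"
      using F(3) d unfolding convex_fun_def by simp
    finally have "m \<le> (1 - 1/d) * a + 1/d * r"
      using a real by simp
    then have "m * d \<le> (d - 1) * a + r"
      using d by (simp add: field_simps)
    then show ?thesis using real by (simp add: d_def algebra_simps)
  next
    case MInf
    then show ?thesis using F(1) by (simp add: proper_fun_def)
  qed simp
  define e where "e = norm (x0 - w)"
  \<comment> \<open>At distance \<open>d\<close> from \<open>x0\<close>, the condition d >= 2 s (a -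
    m) + 2 e yields (d - e)^2 - e^2 >= 2 s d (a - m): the quadratic term outweighs the linear decay
    of the minorant. The minorant holds from distance 1 on, hence the maximum.\<close>
  define R where "R = max 1 (2 * s * (a - m) + 2 * e)"
  have far: "\<phi> x0 \<le> \<phi> x" if "norm (x - x0) > R" for x
  proof -
    define d where "d = norm (x - x0)"
    have d: "d \<ge> 1" "d \<ge> 2 * s * (a - m) + 2 * e" using that by (auto simp: d_def R_def)
    have "\<bar>d - e\<bar> \<le> norm (x - w)"
    proof -
      have "\<bar>norm (x - x0) - norm (w - x0)\<bar> \<le> norm ((x - x0) - (w - x0))"
        by (rule norm_triangle_ineq3)
      then show ?thesis by (simp add: d_def e_def norm_minus_commute)
    qed
    then have "(d - e)\<^sup>2 \<le> (norm (x - w))\<^sup>2"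
      by (metis abs_le_square_iff abs_norm_cancel)
    moreover have "e\<^sup>2 + 2 * s * (d * (a - m)) \<le> (d - e)\<^sup>2"
    proof -
      have "d * (2 * s * (a - m) + 2 * e) \<le> d * d"
        using d by (intro mult_left_mono) auto
      then show ?thesis by (simp add: power2_eq_square algebra_simps)
    qed
    ultimately have "e\<^sup>2 + 2 * s * (d * (a - m)) \<le> (norm (x - w))\<^sup>2" by simp
    then have "1 / (2 * s) * (e\<^sup>2 + 2 * s * (d * (a - m))) \<le> 1 / (2 * s) * (norm (x - w))\<^sup>2"
      using s by (intro mult_left_mono) auto
    then have "1 / (2 * s) * e\<^sup>2 + d * (a - m) \<le> 1 / (2 * s) * (norm (x - w))\<^sup>2"
      using s by (simp add: distrib_left)
    then have "\<phi> x0 \<le> ereal (a - d * (a - m)) + ereal (1 / (2 * s) * (norm (x - w))\<^sup>2)"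
      using a by (simp add: \<phi>_def e_def)
    also have "\<dots> \<le> \<phi> x"
      unfolding \<phi>_def using minorant[of x] d by (intro add_mono) (auto simp: d_def)
    finally show ?thesis .
  qed
  have "R \<ge> 0" by (simp add: R_def)
  then obtain x where x: "x \<in> cball x0 R" "\<And>z. z \<in> cball x0 R \<Longrightarrow> \<phi> x \<le> \<phi> z"
    using lsc_attains_inf[of "cball x0 R" \<phi>] lsc\<phi> by auto
  have "\<phi> x \<le> \<phi> z" for z
  proof (cases "z \<in> cball x0 R")
    case False
    then have "\<phi> x0 \<le> \<phi> z"
      by (intro far) (simp add: dist_norm norm_minus_commute)
    moreover have "\<phi> x \<le> \<phi> x0" using \<open>R \<ge> 0\<close> by (intro x(2)) simp
    ultimately show ?thesis by (rule order_trans[rotated])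
  qed (rule x(2))
  \<comment> \<open>\<open>prox\<close> chooses among the minimisers, so it inherits the property as
    soon as one of them exists.\<close>
  then have "is_arg_min \<phi> (\<lambda>_. True) x" by (simp add: is_arg_min_linorder)
  then have "is_arg_min \<phi> (\<lambda>_. True) (prox s F w)"
    unfolding prox_def arg_min_def \<phi>_def by (rule someI)
  then show ?thesis by (simp add: is_arg_min_linorder \<phi>_def)
qed

lemma prox_in_effective_domain:
  fixes F :: "'a::euclidean_space \<Rightarrow> ereal"
  assumes F: "proper_fun F" "closed_fun F" "convex_fun F" and s: "s > 0"
  shows "prox s F w \<in> effective_domain F"
proof -
  obtain x0 where x0: "F x0 < \<infinity>"
    using F(1) by (auto simp: proper_fun_def effective_domain_def)
  show ?thesis
    using prox_is_arg_min[OF assms, of w x0] x0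
    by (cases "F (prox s F w)"; cases "F x0") (auto simp: effective_domain_def)
qed

text \<open>Moving from the minimiser a fraction \<open>u\<close> of the way to \<open>z\<close>
  cannot lower the proximal objective. Convexity bounds the change by
  \<open>u * (c + u * q)\<close>, where \<open>c\<close> is the slack of the subgradient inequality;
  dividing by \<open>u\<close> and letting it tend to 0 gives \<open>c\<close> nonnegative.\<close>

lemma prox_subgradient:
  fixes F :: "'a::euclidean_space \<Rightarrow> ereal"
  assumes F: "proper_fun F" "closed_fun F" "convex_fun F" and s: "s > 0"
  shows "(1 / s) *\<^sub>R (w - prox s F w) \<in> subdifferential F (prox s F w)"
proof -
  define x where "x = prox s F w"
  have dom: "x \<in> effective_domain F"
    unfolding x_def by (rule prox_in_effective_domain[OF assms])
  obtain a where a: "F x = ereal a" by (rule proper_fun_finite[OF F(1) dom])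
  have "F x + ereal ((1 / s) *\<^sub>R (w - x) \<bullet> (z - x)) \<le> F z" for z
  proof (cases "F z")
    case (real r)
    define c where "c = r - a - ((1 / s) *\<^sub>R (w - x)) \<bullet> (z - x)"
    define q where "q = 1 / (2 * s) * (norm (z - x))\<^sup>2"
    have step: "0 \<le> c + u * q" if u: "0 < u" "u < 1" for u
    proof -
      have eq: "(1 - u) *\<^sub>R x + u *\<^sub>R z - w = (x - w) + u *\<^sub>R (z - x)"
        by (simp add: scaleR_left_diff_distrib scaleR_right_diff_distrib)
      have "F x + ereal (1 / (2 * s) * (norm (x - w))\<^sup>2) \<le>
            F ((1 - u) *\<^sub>R x + u *\<^sub>R z)
              + ereal (1 / (2 * s) * (norm ((1 - u) *\<^sub>R x + u *\<^sub>R z - w))\<^sup>2)"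
        unfolding x_def by (rule prox_is_arg_min[OF assms])
      also have "\<dots> \<le> (ereal (1 - u) * F x + ereal u * F z)
              + ereal (1 / (2 * s) * (norm ((1 - u) *\<^sub>R x + u *\<^sub>R z - w))\<^sup>2)"
        using F(3) u unfolding convex_fun_def by (intro add_right_mono) simp
      finally have "a + 1 / (2 * s) * (norm (x - w))\<^sup>2 \<le>
          ((1 - u) * a + u * r) + 1 / (2 * s) * (norm ((x - w) + u *\<^sub>R (z - x)))\<^sup>2"
        by (simp add: a real eq)
      also have "(norm ((x - w) + u *\<^sub>R (z - x)))\<^sup>2
          = (norm (x - w))\<^sup>2 + 2 * u * ((x - w) \<bullet> (z - x)) + u\<^sup>2 * (norm (z - x))\<^sup>2"
        by (simp only: power2_norm_eq_inner inner_simps)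
           (simp add: algebra_simps inner_commute power2_eq_square)
      finally have "0 \<le> u * (r - a) + 1 / (2 * s) *
          (2 * u * ((x - w) \<bullet> (z - x)) + u\<^sup>2 * (norm (z - x))\<^sup>2)"
        by (simp only: distrib_left) (simp add: algebra_simps)
      moreover have "c = r - a + 1 / (2 * s) * (2 * ((x - w) \<bullet> (z - x)))"
        by (simp add: c_def inner_diff_left diff_divide_distrib)
      ultimately have "0 \<le> u * (c + u * q)"
        by (simp add: q_def power2_eq_square distrib_left add_divide_distrib)
      then show ?thesis using u by (simp add: zero_le_mult_iff)
    qed
    have "((\<lambda>u. c + u * q) \<longlongrightarrow> c + 0 * q) (at_right 0)"
      by (intro tendsto_intros)
    moreover have "\<forall>\<^sub>F u in at_right 0. 0 \<le> c + u * q"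
      by (rule eventually_mono[OF eventually_at_right_real[OF zero_less_one]]) (use step in auto)
    ultimately have "0 \<le> c"
      using tendsto_lowerbound[of "\<lambda>u. c + u * q" "c + 0 * q" "at_right 0" 0] by simp
    then show ?thesis by (simp add: a real c_def)
  next
    case MInf
    then show ?thesis using F(1) by (simp add: proper_fun_def)
  qed simp
  then show ?thesis using dom by (simp add: subdifferential_def x_def)
qed


section \<open>Smooth convex functions\<close>

lemma GDERIV_along_line:
  assumes "GDERIV f (x + u *\<^sub>R d) :> D"
  shows "((\<lambda>u. f (x + u *\<^sub>R d)) has_real_derivative D \<bullet> d) (at u)"
proof -
  have "((\<lambda>u. f (x + u *\<^sub>R d)) has_derivative (\<lambda>h. (h *\<^sub>R d) \<bullet> D)) (at u)"
    using assms unfolding gderiv_def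
    by (intro has_derivative_compose[where f = "\<lambda>u. x + u *\<^sub>R d" and g = f])
       (auto intro!: derivative_eq_intros)
  then show ?thesis
    by (simp add: has_field_derivative_def inner_commute mult_commute_abs)
qed

text \<open>Restriction to the line through \<open>x\<close> and \<open>z\<close> reduces this to
  the tangent inequality in one real variable.\<close>

lemma convex_gradient_ineq:
  assumes f: "convex_on UNIV f" and D: "GDERIV f x :> D"
  shows "f x + D \<bullet> (z - x) \<le> f z"
proof -
  define \<phi> where "\<phi> = (\<lambda>u. f (x + u *\<^sub>R (z - x)))"
  have "convex_on UNIV \<phi>"
  proof (rule convex_onI)
    fix u p q :: real assume "0 < u" "u < 1"
    moreover have "x + ((1 - u) *\<^sub>R p + u *\<^sub>R q) *\<^sub>R (z - x)
        = (1 - u) *\<^sub>R (x + p *\<^sub>R (z - x)) + u *\<^sub>R (x + q *\<^sub>R (z - x))"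
      by (simp add: algebra_simps)
    ultimately show "\<phi> ((1 - u) *\<^sub>R p + u *\<^sub>R q) \<le> (1 - u) * \<phi> p + u * \<phi> q"
      unfolding \<phi>_def using convex_onD[OF f, of u] by simp
  qed simp
  moreover have "(\<phi> has_real_derivative D \<bullet> (z - x)) (at 0)"
    unfolding \<phi>_def using D by (intro GDERIV_along_line) simp
  ultimately have "(D \<bullet> (z - x)) * (1 - 0) \<le> \<phi> 1 - \<phi> 0"
    by (intro convex_on_imp_above_tangent[of UNIV]) auto
  then show ?thesis by (simp add: \<phi>_def)
qed

lemma lipschitz_gradient_descent:
  assumes D: "\<And>x. GDERIV f x :> G x" and L: "L-lipschitz_on UNIV G"
  shows "f z \<le> f x + G x \<bullet> (z - x) + L / 2 * (norm (z - x))\<^sup>2"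
proof -
  define d where "d = z - x"
  \<comment> \<open>\<open>\<phi>\<close> is \<open>f\<close> along the segment minus the varying
    part of its quadratic upper model; the Lipschitz bound makes its derivative nonpositive on the
    unit interval.\<close>
  define \<phi> where "\<phi> = (\<lambda>u. f (x + u *\<^sub>R d) - u * (G x \<bullet> d) - L / 2 * (norm d)\<^sup>2 * u\<^sup>2)"
  have "\<phi> 1 \<le> \<phi> 0"
  proof (rule DERIV_nonpos_imp_nonincreasing[of 0 1])
    fix u :: real assume u: "0 \<le> u" "u \<le> 1"
    let ?D = "G (x + u *\<^sub>R d) \<bullet> d - G x \<bullet> d - L * (norm d)\<^sup>2 * u"
    have "(\<phi> has_real_derivative ?D) (at u)"
      unfolding \<phi>_def
      by (rule derivative_eq_intros GDERIV_along_line D refl | simp)+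
    moreover have "?D \<le> 0"
    proof -
      have "(G (x + u *\<^sub>R d) - G x) \<bullet> d \<le> norm (G (x + u *\<^sub>R d) - G x) * norm d"
        by (rule norm_cauchy_schwarz)
      also have "\<dots> \<le> (L * norm (u *\<^sub>R d)) * norm d"
        using lipschitz_onD[OF L, of "x + u *\<^sub>R d" x]
        by (intro mult_right_mono) (auto simp: dist_norm)
      finally show ?thesis
        using u by (simp add: inner_diff_left power2_eq_square algebra_simps)
    qed
    ultimately show "\<exists>y. (\<phi> has_real_derivative y) (at u) \<and> y \<le> 0" by blast
  qed simp
  then show ?thesis by (simp add: \<phi>_def d_def)
qed

section \<open>Bounds from weighted sums\<close>

text \<open>Each partial sum is a convex combination of the previous one and a vector bounded by
  hypothesis, so all of them stay in the ball of radius \<open>M\<close>. Every \<open>a k\<close>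
  is then a difference of two vectors of that ball.\<close>

lemma weighted_sums_bounded:
  fixes a :: "nat \<Rightarrow> 'a::real_normed_vector" and c :: "nat \<Rightarrow> real"
  assumes c: "\<And>i. i \<ge> 1 \<Longrightarrow> 0 \<le> c i \<and> c i \<le> 1"
    and bound: "\<And>k. k \<ge> 1 \<Longrightarrow> norm (a k + (\<Sum>i=1..<k. c i *\<^sub>R a i)) \<le> M"
    and k: "k \<ge> 1"
  shows "norm (a k) \<le> 2 * M"
proof -
  have M: "0 \<le> M" using bound[of 1] norm_ge_zero order_trans by blast
  have S: "norm (\<Sum>i=1..<k. c i *\<^sub>R a i) \<le> M"
    using k
  proof (induction k rule: dec_induct)
    case base
    then show ?case using M by simp
  next
    case (step k)
    let ?S = "\<Sum>i=1..<k. c i *\<^sub>R a i"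
    have "(\<Sum>i=1..<Suc k. c i *\<^sub>R a i) = (1 - c k) *\<^sub>R ?S + c k *\<^sub>R (a k + ?S)"
      using step.hyps by (simp add: algebra_simps)
    also have "norm \<dots> \<le> (1 - c k) * norm ?S + c k * norm (a k + ?S)"
      using c[of k] step.hyps by (intro order_trans[OF norm_triangle_ineq]) simp
    also have "\<dots> \<le> (1 - c k) * M + c k * M"
      using c[of k] step bound[of k] by (intro add_mono mult_left_mono) auto
    finally show ?case by (simp add: algebra_simps)
  qed
  have "norm (a k) \<le> norm (a k + (\<Sum>i=1..<k. c i *\<^sub>R a i)) + norm (\<Sum>i=1..<k. c i *\<^sub>R a i)"
    using norm_triangle_ineq4[of "a k + (\<Sum>i=1..<k. c i *\<^sub>R a i)" "\<Sum>i=1..<k. c i *\<^sub>R a i"]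
    by simp
  then show ?thesis using bound[OF k] S by simp
qed

section \<open>Saddle points\<close>

lemma saddle_point_finite:
  assumes g: "proper_fun g" and s: "(ys, ls) \<in> saddle_points g B b"
  shows "ys \<in> effective_domain g"
proof -
  obtain x where x: "g x < \<infinity>"
    using g by (auto simp: proper_fun_def effective_domain_def)
  have "lagrangian g B b ys ls \<le> lagrangian g B b x ls"
    using s by (auto simp: saddle_points_def)
  then show ?thesis
    using x by (cases "g ys") (auto simp: lagrangian_def effective_domain_def)
qed

lemma saddle_point_feasible:
  assumes g: "proper_fun g" and s: "(ys, ls) \<in> saddle_points g B b"
  shows "B *v ys = b"
proof -
  obtain a where a: "g ys = ereal a"
    using proper_fun_finite[OF g saddle_point_finite[OF assms]] by blast
  let ?r = "B *v ys - b"
  \<comment> \<open>The multiplier is perturbed in the direction of the residual. The finite value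
    \<open>g ys\<close> cancels, leaving a bound on the squared norm of the residual.\<close>
  have "lagrangian g B b ys (ls + ?r) \<le> lagrangian g B b ys ls"
    using s by (auto simp: saddle_points_def)
  then have "?r \<bullet> ?r \<le> 0"
    by (simp add: lagrangian_def a inner_add_left)
  then have "?r \<bullet> ?r = 0" using inner_ge_zero[of ?r] by (rule antisym)
  then show ?thesis by simp
qed

section \<open>One-step decrease of the energy\<close>

text \<open>Convexity of \<open>f1\<close> handles the average \<open>y'\<close>. For
  \<open>f2\<close>, the descent inequality is taken at \<open>yb\<close> and its linear part is
  split between the tangent inequalities towards \<open>y\<close> and towards \<open>z\<close>. The
  linear constraint does not enter yet.\<close>

lemma accelerated_primal_decrease:
  fixes f1 f2 :: "'a::real_inner \<Rightarrow> real" and G :: "'a \<Rightarrow> 'a"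
  assumes f1: "\<And>x z u. x \<in> D \<Longrightarrow> z \<in> D \<Longrightarrow> 0 \<le> u \<Longrightarrow> u \<le> 1 \<Longrightarrow>
      f1 ((1 - u) *\<^sub>R x + u *\<^sub>R z) \<le> (1 - u) * f1 x + u * f1 z"
    and f2: "convex_on UNIV f2" "\<And>x. GDERIV f2 x :> G x" "L-lipschitz_on UNIV G"
    and dom: "y \<in> D" "v' \<in> D" and t: "t \<ge> 1"
    and yb: "yb = y + (1 / t) *\<^sub>R (v - y)"
    and y': "y' = (1 / t) *\<^sub>R v' + ((t - 1) / t) *\<^sub>R y"
    and sub: "f1 v' + \<xi> \<bullet> (z - v') + \<mu> / 2 * (norm (z - v'))\<^sup>2 \<le> f1 z"
  shows "t\<^sup>2 * (f1 y' + f2 y' - (f1 z + f2 z))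
    \<le> (t\<^sup>2 - t) * (f1 y + f2 y - (f1 z + f2 z)) + t * ((\<xi> + G yb) \<bullet> (v' - z))
      - t * \<mu> / 2 * (norm (v' - z))\<^sup>2 + L / 2 * (norm (v' - v))\<^sup>2"
proof -
  have y'2: "y' = (1 - 1 / t) *\<^sub>R y + (1 / t) *\<^sub>R v'"
    using t by (simp add: y' diff_divide_distrib)
  have F1: "f1 y' \<le> (1 - 1 / t) * f1 y + (1 / t) * f1 v'"
    unfolding y'2 using t dom by (intro f1) auto
  \<comment> \<open>The extrapolation is designed for this identity: the quadratic error of the
    descent inequality carries 1 / t^2, which the final factor t^2 cancels.\<close>
  have dy: "y' - yb = (1 / t) *\<^sub>R (v' - v)"
    by (simp add: y'2 yb algebra_simps)
  have dy2: "y' - yb = (1 - 1 / t) *\<^sub>R (y - yb) + (1 / t) *\<^sub>R (v' - yb)"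
    by (simp add: y'2 algebra_simps)
  have gr: "G yb \<bullet> (y' - yb) = (1 - 1 / t) * (G yb \<bullet> (y - yb)) + (1 / t) * (G yb \<bullet> (v' - yb))"
    unfolding dy2 by (simp add: inner_add_right)
  have "f2 y' \<le> f2 yb + G yb \<bullet> (y' - yb) + L / 2 * (norm (y' - yb))\<^sup>2"
    using f2 by (intro lipschitz_gradient_descent)
  also have "\<dots> = (1 - 1 / t) * (f2 yb + G yb \<bullet> (y - yb))
      + (1 / t) * (f2 yb + G yb \<bullet> (z - yb) + G yb \<bullet> (v' - z))
      + L / 2 * (norm ((1 / t) *\<^sub>R (v' - v)))\<^sup>2"
    unfolding gr by (simp only: dy) (simp add: algebra_simps inner_diff_right)
  also have "\<dots> \<le> (1 - 1 / t) * f2 y + (1 / t) * (f2 z + G yb \<bullet> (v' - z))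
      + L / 2 * (norm ((1 / t) *\<^sub>R (v' - v)))\<^sup>2"
    using t by (intro add_mono mult_left_mono order_refl convex_gradient_ineq f2) auto
  finally have F2: "f2 y' \<le> (1 - 1 / t) * f2 y + (1 / t) * (f2 z + G yb \<bullet> (v' - z))
      + L / 2 * (norm ((1 / t) *\<^sub>R (v' - v)))\<^sup>2" .
  define n where "n = (norm (v' - v))\<^sup>2"
  have n: "(norm ((1 / t) *\<^sub>R (v' - v)))\<^sup>2 = n / t\<^sup>2"
    by (simp add: n_def power_divide power_mult_distrib)
  define m where "m = (norm (v' - z))\<^sup>2"
  define p where "p = G yb \<bullet> (v' - z)"
  define q where "q = \<xi> \<bullet> (v' - z)"
  have sub': "f1 v' \<le> f1 z + q - \<mu> / 2 * m"
    using sub by (simp add: q_def m_def norm_minus_commute inner_diff_right)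
  have "(1 / t) * f1 v' \<le> (1 / t) * (f1 z + q - \<mu> / 2 * m)"
    using sub' t by (intro mult_left_mono) auto
  with F1 F2 have "f1 y' + f2 y' \<le> (1 - 1 / t) * (f1 y + f2 y)
      + (1 / t) * (f1 z + f2 z + q + p - \<mu> / 2 * m) + L / 2 * (n / t\<^sup>2)"
    unfolding n p_def[symmetric] by (simp add: algebra_simps)
  then have "t\<^sup>2 * (f1 y' + f2 y') \<le> t\<^sup>2 * ((1 - 1 / t) * (f1 y + f2 y)
      + (1 / t) * (f1 z + f2 z + q + p - \<mu> / 2 * m) + L / 2 * (n / t\<^sup>2))"
    by (intro mult_left_mono) auto
  also have "\<dots> = (t\<^sup>2 - t) * (f1 y + f2 y) + t * (f1 z + f2 z + q + p - \<mu> / 2 * m) + L / 2 * n"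
    using t by (simp add: field_simps power2_eq_square)
  finally show ?thesis
    unfolding n_def[symmetric] m_def[symmetric] inner_add_left p_def[symmetric] q_def[symmetric]
    by (simp add: algebra_simps)
qed

text \<open>Three-point identity, used to turn inner products of successive differences into
  telescoping squared distances.\<close>

lemma two_inner_diff:
  fixes x y z :: "'a::real_inner"
  shows "2 * ((x - y) \<bullet> (x - z)) = (norm (x - z))\<^sup>2 + (norm (x - y))\<^sup>2 - (norm (y - z))\<^sup>2"
  by (simp add: power2_norm_eq_inner inner_diff_left inner_diff_right inner_commute)


lemma inner_transpose_mult:
  fixes B :: "real^'n^'p"
  shows "(transpose B *v u) \<bullet> x = u \<bullet> (B *v x)"
  by (simp add: dot_lmul_matrix)

lemma residual_of_average:
  fixes B :: "real^'n^'p" and t :: real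
  assumes "t \<noteq> 0" and y': "y' = (1 / t) *\<^sub>R v' + ((t - 1) / t) *\<^sub>R y"
  shows "t\<^sup>2 *\<^sub>R (B *v y' - b) = t *\<^sub>R (B *v v' - b) + (t\<^sup>2 - t) *\<^sub>R (B *v y - b)"
proof -
  have "t *\<^sub>R y' = v' + (t - 1) *\<^sub>R y"
    using assms by (simp add: scaleR_right_distrib)
  then have "t *\<^sub>R (B *v y') = B *v v' + (t - 1) *\<^sub>R (B *v y)"
    by (metis matrix_vector_mult_scaleR matrix_vector_right_distrib)
  then have "t *\<^sub>R (t *\<^sub>R (B *v y')) = t *\<^sub>R (B *v v' + (t - 1) *\<^sub>R (B *v y))"
    by simp
  then show ?thesis by (simp add: power2_eq_square algebra_simps)
qed

text \<open>In the application \<open>s\<close>, \<open>t\<close> and \<open>T\<close> are three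
  consecutive members of the parameter sequence, and \<open>d\<close>, \<open>d'\<close> are the
  objective values at \<open>y\<close>, \<open>y'\<close> minus the optimal one. Here the constraint
  enters, and the multiplier terms become distances to \<open>ls\<close>.\<close>

lemma accelerated_energy_decrease:
  fixes B :: "real^'n^'p" and d d' :: real
  assumes primal: "t\<^sup>2 * d' \<le> (t\<^sup>2 - t) * d
        + t * (((t / \<beta>) *\<^sub>R (v - v') - transpose B *v lb) \<bullet> (v' - z))
        - t * \<mu> / 2 * (norm (v' - z))\<^sup>2 + L / 2 * (norm (v' - v))\<^sup>2"
    and z: "B *v z = b"
    and y': "y' = (1 / t) *\<^sub>R v' + ((t - 1) / t) *\<^sub>R y"
    and lb: "lb = l + (\<gamma> * t) *\<^sub>R (B *v v - b)"
    and l': "l' = l + (\<gamma> * t) *\<^sub>R (B *v v' - b)"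
    and gap: "0 \<le> d + ls \<bullet> (B *v y - b)"
    and pos: "t \<ge> 1" "\<beta> > 0" "\<gamma> > 0"
    and step: "\<beta> * (L + t\<^sup>2 * \<gamma> * (onorm (\<lambda>x. B *v x))\<^sup>2) \<le> t\<^sup>2"
    and t1: "t\<^sup>2 \<le> s\<^sup>2 + t" and t2: "T\<^sup>2 \<le> t\<^sup>2 + \<beta> * \<mu> * t"
  shows "t\<^sup>2 * (d' + ls \<bullet> (B *v y' - b)) + T\<^sup>2 / (2 * \<beta>) * (norm (v' - z))\<^sup>2
            + 1 / (2 * \<gamma>) * (norm (l' - ls))\<^sup>2
      \<le> s\<^sup>2 * (d + ls \<bullet> (B *v y - b)) + t\<^sup>2 / (2 * \<beta>) * (norm (v - z))\<^sup>2
            + 1 / (2 * \<gamma>) * (norm (l - ls))\<^sup>2"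
proof -
  define P where "P = (norm (v' - z))\<^sup>2"
  define Q where "Q = (norm (v' - v))\<^sup>2"
  define R where "R = (norm (v - z))\<^sup>2"
  define N where "N = (norm (l - ls))\<^sup>2"
  define N' where "N' = (norm (l' - ls))\<^sup>2"
  define K where "K = (onorm (\<lambda>x. B *v x))\<^sup>2"
  define r where "r = ls \<bullet> (B *v y - b)"
  define r' where "r' = ls \<bullet> (B *v y' - b)"
  define W where "W = (\<gamma> * t) *\<^sub>R (B *v (v' - v))"
  have PQR: "(v - v') \<bullet> (v' - z) = (R - P - Q) / 2"
    using two_inner_diff[of v' v z] by (simp add: P_def Q_def R_def inner_diff_left)
  have feas: "t\<^sup>2 * r' = t * (ls \<bullet> (B *v v' - b)) + (t\<^sup>2 - t) * r"
  proof -
    have "t\<^sup>2 *\<^sub>R (B *v y' - b) = t *\<^sub>R (B *v v' - b) + (t\<^sup>2 - t) *\<^sub>R (B *v y - b)"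
      using pos(1) by (intro residual_of_average y') auto
    then have "ls \<bullet> (t\<^sup>2 *\<^sub>R (B *v y' - b))
        = ls \<bullet> (t *\<^sub>R (B *v v' - b) + (t\<^sup>2 - t) *\<^sub>R (B *v y - b))" by simp
    then show ?thesis by (simp add: r_def r'_def inner_add_right)
  qed
  \<comment> \<open>\<open>W\<close> is the prediction error \<open>l' - lb\<close>. Young's
    inequality for its product with \<open>l' - l\<close> creates exactly the squared norm that the
    three-point identity removes, so besides the telescoping \<open>N - N'\<close> only a multiple
    of \<open>Q\<close> is left.\<close>
  have dual: "t * ((ls - lb) \<bullet> (B *v v' - b)) \<le> 1 / (2 * \<gamma>) * (N - N') + \<gamma> * t\<^sup>2 * K * Q / 2"
  proof -
    have lsb: "ls - lb = W - (l' - ls)"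
      by (simp add: lb l' W_def matrix_vector_mult_diff_distrib algebra_simps)
    have x: "(\<gamma> * t) *\<^sub>R (B *v v' - b) = l' - l" by (simp add: l')
    have "2 * \<gamma> * (t * ((ls - lb) \<bullet> (B *v v' - b))) = 2 * ((ls - lb) \<bullet> ((\<gamma> * t) *\<^sub>R (B *v v' - b)))"
      by simp
    also have "\<dots> = 2 * (W \<bullet> (l' - l)) - 2 * ((l' - l) \<bullet> (l' - ls))"
      unfolding x lsb by (simp add: inner_diff_left inner_diff_right inner_commute)
    also have "2 * (W \<bullet> (l' - l)) \<le> (norm W)\<^sup>2 + (norm (l' - l))\<^sup>2"
    proof -
      have "0 \<le> (norm (W - (l' - l)))\<^sup>2" by simp
      then show ?thesis by (simp only: power2_norm_eq_inner inner_simps) (simp add: inner_commute)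
    qed
    also have "2 * ((l' - l) \<bullet> (l' - ls)) = N' + (norm (l' - l))\<^sup>2 - N"
      using two_inner_diff[of l' l ls] by (simp add: N_def N'_def)
    also have "(norm W)\<^sup>2 \<le> \<gamma>\<^sup>2 * t\<^sup>2 * (K * Q)"
    proof -
      have "norm (B *v (v' - v)) \<le> onorm (\<lambda>x. B *v x) * norm (v' - v)"
        by (rule onorm[OF matrix_vector_mul_bounded_linear])
      then have "(norm (B *v (v' - v)))\<^sup>2 \<le> K * Q"
        unfolding K_def Q_def power_mult_distrib[symmetric] by (intro power_mono) auto
      then show ?thesis
        by (simp add: W_def power_mult_distrib mult_left_mono)
    qed
    finally have "2 * \<gamma> * (t * ((ls - lb) \<bullet> (B *v v' - b))) \<le> N - N' + \<gamma>\<^sup>2 * t\<^sup>2 * (K * Q)"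
      by simp
    then show ?thesis using pos(3) by (simp add: field_simps power2_eq_square)
  qed
  have "(transpose B *v lb) \<bullet> (v' - z) = lb \<bullet> (B *v v' - b)"
    by (simp only: inner_transpose_mult matrix_vector_mult_diff_distrib z)
  then have "t\<^sup>2 * d' \<le> (t\<^sup>2 - t) * d + t * ((t / \<beta>) * ((R - P - Q) / 2) - lb \<bullet> (B *v v' - b))
      - t * \<mu> / 2 * P + L / 2 * Q"
    using primal unfolding inner_diff_left[of "(t / \<beta>) *\<^sub>R (v - v')"] inner_scaleR_left PQR
    by (simp add: P_def Q_def)
  moreover have "t * ((t / \<beta>) * ((R - P - Q) / 2)) = t\<^sup>2 / (2 * \<beta>) * (R - P - Q)"
    by (simp add: power2_eq_square)
  ultimately have "t\<^sup>2 * (d' + r') \<le> (t\<^sup>2 - t) * (d + r) + t * ((ls - lb) \<bullet> (B *v v' - b))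
      + t\<^sup>2 / (2 * \<beta>) * (R - P - Q) - t * \<mu> / 2 * P + L / 2 * Q"
    using feas unfolding inner_diff_left right_diff_distrib[of t] distrib_left by linarith
  \<comment> \<open>The next three facts spend the parameter conditions: the nonnegative gap allows
    its weight to grow to s^2, the step-size bound absorbs the \<open>Q\<close> terms, and strong
    convexity pays for the growth of the distance weight from t^2 to T^2.\<close>
  moreover have "(t\<^sup>2 - t) * (d + r) \<le> s\<^sup>2 * (d + r)"
    using t1 gap by (intro mult_right_mono) (auto simp: r_def)
  moreover have "(L / 2 + \<gamma> * t\<^sup>2 * K / 2) * Q \<le> t\<^sup>2 / (2 * \<beta>) * Q"
    using step pos(2) by (intro mult_right_mono) (auto simp: K_def Q_def field_simps)
  moreover have "T\<^sup>2 / (2 * \<beta>) * P \<le> (t\<^sup>2 / (2 * \<beta>) + t * \<mu> / 2) * P"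
    using t2 pos(2) by (intro mult_right_mono) (auto simp: P_def field_simps)
  ultimately show ?thesis
    using dual
    unfolding P_def[symmetric] R_def[symmetric] N_def[symmetric] N'_def[symmetric]
      r_def[symmetric] r'_def[symmetric]
    by (simp add: algebra_simps diff_divide_distrib add_divide_distrib)
qed

section \<open>Decay of the constraint residual\<close>

text \<open>The multiplier updates telescope, so bounded multipliers bound a scaled residual plus a
  weighted sum of its predecessors; \<open>weighted_sums_bounded\<close> removes that sum at the
  cost of a factor 2.\<close>

lemma feasibility_rate:
  fixes B :: "real^'n^'p" and t :: "nat \<Rightarrow> real"
  assumes t: "\<And>k. k \<ge> 1 \<Longrightarrow> t k \<ge> 1"
    and t_step: "\<And>k. k \<ge> 1 \<Longrightarrow> (t (k + 1))\<^sup>2 \<le> (t k)\<^sup>2 + t (k + 1)"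
    and \<gamma>: "\<gamma> > 0"
    and y: "\<And>k. k \<ge> 1 \<Longrightarrow>
      y (k + 1) = (1 / t (k + 1)) *\<^sub>R v (k + 1) + ((t (k + 1) - 1) / t (k + 1)) *\<^sub>R y k"
    and l: "\<And>k. k \<ge> 1 \<Longrightarrow> l (k + 1) = l k + (\<gamma> * t (k + 1)) *\<^sub>R (B *v v (k + 1) - b)"
    and bound: "\<And>k. k \<ge> 1 \<Longrightarrow> norm (l k - ls) \<le> S"
    and k: "k \<ge> 1"
  shows "(t k)\<^sup>2 * norm (B *v y k - b)
           \<le> 2 * ((t 1)\<^sup>2 * norm (B *v y 1 - b) + (norm (l 1 - ls) + S) / \<gamma>)"
proof -
  define a where "a = (\<lambda>k. (t k)\<^sup>2 *\<^sub>R (B *v y k - b))"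
  \<comment> \<open>Chosen so that \<open>a (k + 1) + c k *\<^sub>R a k\<close> is
    \<open>a k\<close> plus the multiplier increment divided by \<open>\<gamma>\<close>. It is
    nonnegative by \<open>t_step\<close>, and at most 1 because a number that is at least 1 does not
    exceed its square.\<close>
  define c where "c = (\<lambda>k. ((t k)\<^sup>2 + t (k + 1) - (t (k + 1))\<^sup>2) / (t k)\<^sup>2)"
  have c: "0 \<le> c i \<and> c i \<le> 1" if "i \<ge> 1" for i
  proof -
    have "t (i + 1) \<le> (t (i + 1))\<^sup>2"
      using t[of "i + 1"] by (intro self_le_power) auto
    moreover have "0 < (t i)\<^sup>2" using t[OF that] by simp
    ultimately show ?thesis using t_step[OF that] by (simp add: c_def)
  qed
  have sum: "a k + (\<Sum>i=1..<k. c i *\<^sub>R a i) = a 1 + (1 / \<gamma>) *\<^sub>R (l k - l 1)" if "k \<ge> 1" for k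
    using that
  proof (induction k rule: dec_induct)
    case base
    then show ?case by simp
  next
    case (step k)
    define \<tau> where "\<tau> = t (k + 1)"
    have \<tau>: "\<tau> \<ge> 1" and tk: "t k \<ge> 1" using t[of "k + 1"] t[of k] step.hyps by (auto simp: \<tau>_def)
    have "\<tau>\<^sup>2 *\<^sub>R (B *v y (k + 1) - b)
        = \<tau> *\<^sub>R (B *v v (k + 1) - b) + (\<tau>\<^sup>2 - \<tau>) *\<^sub>R (B *v y k - b)"
      using \<tau> y[OF step.hyps(1)] by (intro residual_of_average) (auto simp: \<tau>_def)
    moreover have "\<tau> *\<^sub>R (B *v v (k + 1) - b) = (1 / \<gamma>) *\<^sub>R (l (k + 1) - l k)"
      unfolding l[OF step.hyps(1)] \<tau>_def[symmetric] using \<gamma> by simp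
    moreover have "c k *\<^sub>R a k = ((t k)\<^sup>2 + \<tau> - \<tau>\<^sup>2) *\<^sub>R (B *v y k - b)"
      using tk by (simp add: c_def a_def \<tau>_def)
    ultimately have "a (Suc k) + c k *\<^sub>R a k = a k + (1 / \<gamma>) *\<^sub>R (l (Suc k) - l k)"
      by (simp add: a_def \<tau>_def scaleR_left_diff_distrib scaleR_left_distrib)
    then have "a (Suc k) + (\<Sum>i=1..<Suc k. c i *\<^sub>R a i)
        = (a k + (\<Sum>i=1..<k. c i *\<^sub>R a i)) + (1 / \<gamma>) *\<^sub>R (l (Suc k) - l k)"
      using step.hyps by (simp add: algebra_simps)
    then show ?case unfolding step.IH by (simp add: algebra_simps)
  qed
  have "norm (a k + (\<Sum>i=1..<k. c i *\<^sub>R a i))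
      \<le> (t 1)\<^sup>2 * norm (B *v y 1 - b) + (norm (l 1 - ls) + S) / \<gamma>" if "k \<ge> 1" for k
  proof -
    have "norm (l k - l 1) \<le> norm (l k - ls) + norm (l 1 - ls)"
      using norm_triangle_ineq4[of "l k - ls" "l 1 - ls"] by simp
    then have "norm (l k - l 1) / \<gamma> \<le> (norm (l 1 - ls) + S) / \<gamma>"
      using bound[OF that] \<gamma> by (intro divide_right_mono) auto
    then have "norm (a 1) + norm ((1 / \<gamma>) *\<^sub>R (l k - l 1))
        \<le> (t 1)\<^sup>2 * norm (B *v y 1 - b) + (norm (l 1 - ls) + S) / \<gamma>"
      using \<gamma> by (simp add: a_def)
    then show ?thesis
      unfolding sum[OF that] using norm_triangle_ineq order_trans by blast
  qed
  then have "norm (a k) \<le> 2 * ((t 1)\<^sup>2 * norm (B *v y 1 - b) + (norm (l 1 - ls) + S) / \<gamma>)"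
    using c k by (intro weighted_sums_bounded[of c a]) auto
  then show ?thesis by (simp add: a_def)
qed

section \<open>Convergence rates for residual and objective\<close>

(* The step-size bound is stated in ereal, where a / 0 = \<infinity> for a > 0. *)
theorem theorem8:
  fixes g1 :: "real^'n \<Rightarrow> ereal" and g2 :: "real^'n \<Rightarrow> real" and g :: "real^'n \<Rightarrow> ereal"
    and G2 :: "real^'n \<Rightarrow> real^'n"
    and B :: "real^'n^'p" and b :: "real^'p"
    and \<mu> L \<beta> \<gamma> :: real and t :: "nat \<Rightarrow> real"
    and y v :: "nat \<Rightarrow> real^'n" and l :: "nat \<Rightarrow> real^'p"
    and ys :: "real^'n" and ls :: "real^'p"
    and E1 C4 :: real
  assumes g: "g = (\<lambda>x. g1 x + ereal (g2 x))"
    and g1: "proper_fun g1" "closed_fun g1" "\<mu> > 0" "strongly_convex_fun \<mu> g1"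
    and g2: "convex_on UNIV g2" "\<And>x. GDERIV g2 x :> G2 x" "L-lipschitz_on UNIV G2"
    and saddle_nonempty: "saddle_points g B b \<noteq> {}"
    and params: "\<beta> > 0" "\<gamma> > 0"
    and alg: "accelerated_primal_dual g1 g2 G2 B b \<beta> \<gamma> t y v l"
    and saddle: "(ys, ls) \<in> saddle_points g B b"
    and beta_le: "ereal \<beta> \<le> ereal ((t 1)\<^sup>2) /
                    ereal (L + (t 1)\<^sup>2 * \<gamma> * (onorm (\<lambda>x. B *v x))\<^sup>2)"
    and t_ge: "\<And>k. k \<ge> 1 \<Longrightarrow> t k \<ge> 1"
    and t_mono: "mono_on {1..} t"
    and t_step1: "\<And>k. k \<ge> 1 \<Longrightarrow> (t (k + 1))\<^sup>2 \<le> (t k)\<^sup>2 + t (k + 1)"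
    and t_step2: "\<And>k. k \<ge> 1 \<Longrightarrow> (t (k + 1))\<^sup>2 \<le> (t k)\<^sup>2 + \<beta> * \<mu> * t k"
    and E1: "E1 = (t 1)\<^sup>2 * (real_of_ereal (g (y 1)) - real_of_ereal (g ys)
                              + ls \<bullet> (B *v y 1 - b))
                  + (t 2)\<^sup>2 / (2 * \<beta>) * (norm (y 1 - ys))\<^sup>2
                  + 1 / (2 * \<gamma>) * (norm (l 1 - ls))\<^sup>2"
    and C4: "C4 = 3 * (t 1)\<^sup>2 * norm (B *v y 1 - b)
                  + (2 * norm (l 1 - ls) + 2 * sqrt (2 * \<gamma> * E1)) / \<gamma>"
  shows "\<forall>k\<ge>1. norm (B *v y k - b) \<le> C4 / (t k)\<^sup>2 \<and>
           \<bar>g (y k) - g ys\<bar> \<le> ereal ((E1 + C4 * norm ls) / (t k)\<^sup>2)"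
proof -
  have proper: "proper_fun g1" and closed: "closed_fun g1" and conv: "convex_fun g1"
    using g1 by (auto simp: strongly_convex_fun_def)
  define D where "D = effective_domain g1"
  \<comment> \<open>\<open>real_of_ereal\<close> sends infinity to 0, so \<open>f\<close> represents
    \<open>g1\<close> on \<open>D\<close> only; hence the iterates have to be shown to stay in
    \<open>D\<close>.\<close>
  define f where "f = (\<lambda>x. real_of_ereal (g1 x))"
  have fin: "g1 x = ereal (f x)" if "x \<in> D" for x
    using proper_fun_finite[OF proper that[unfolded D_def]] unfolding f_def by fastforce
  have gfin: "g x = ereal (f x + g2 x)" if "x \<in> D" for x
    using fin[OF that] by (simp add: g)
  have Dg: "effective_domain g = D"
    unfolding D_def effective_domain_def g by auto
  have gproper: "proper_fun g"
    using proper Dg unfolding proper_fun_def D_def by (auto simp: g)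
  have ysD: "ys \<in> D" using saddle_point_finite[OF gproper saddle] Dg by simp
  have feas: "B *v ys = b" by (rule saddle_point_feasible[OF gproper saddle])
  define d where "d = (\<lambda>x. f x + g2 x - (f ys + g2 ys))"
  have gap: "0 \<le> d x + ls \<bullet> (B *v x - b)" if "x \<in> D" for x
  proof -
    have "lagrangian g B b ys ls \<le> lagrangian g B b x ls"
      using saddle by (auto simp: saddle_points_def)
    then show ?thesis
      using gfin[OF that] gfin[OF ysD] feas by (simp add: lagrangian_def d_def)
  qed
  \<comment> \<open>Convexity of \<open>D\<close> comes along, since the right-hand side of the
    \<open>ereal\<close> inequality is finite.\<close>
  have fconv: "(1 - u) *\<^sub>R x + u *\<^sub>R z \<in> D \<and>
      f ((1 - u) *\<^sub>R x + u *\<^sub>R z) \<le> (1 - u) * f x + u * f z"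
    if "x \<in> D" "z \<in> D" "0 \<le> u" "u \<le> 1" for x z u
  proof -
    have "g1 ((1 - u) *\<^sub>R x + u *\<^sub>R z) \<le> ereal (1 - u) * g1 x + ereal u * g1 z"
      using conv that unfolding convex_fun_def by simp
    then have le: "g1 ((1 - u) *\<^sub>R x + u *\<^sub>R z) \<le> ereal ((1 - u) * f x + u * f z)"
      using fin that by simp
    then have "(1 - u) *\<^sub>R x + u *\<^sub>R z \<in> D"
      by (auto simp: D_def effective_domain_def)
    then show ?thesis using le fin by simp
  qed
  have strong: "f x + \<xi> \<bullet> (ys - x) + \<mu> / 2 * (norm (ys - x))\<^sup>2 \<le> f ys"
    if "\<xi> \<in> subdifferential g1 x" for \<xi> x
  proof -
    have "x \<in> D" using that by (simp add: subdifferential_def D_def)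
    moreover have "ereal (\<mu> / 2 * (norm (ys - x))\<^sup>2) \<le> g1 ys - g1 x - ereal (\<xi> \<bullet> (ys - x))"
      using g1(4) that unfolding strongly_convex_fun_def by blast
    ultimately show ?thesis using fin ysD by simp
  qed

  have y01: "y 1 = y 0" "v 1 = y 1" "y 1 \<in> D"
    using alg Dg by (auto simp: accelerated_primal_dual_def g)
  define yb where "yb = (\<lambda>k. y k + ((t k - 1) / t (k + 1)) *\<^sub>R (y k - y (k - 1)))"
  define lb where "lb = (\<lambda>k. l k + (\<gamma> * t (k + 1)) *\<^sub>R (B *v v k - b))"
  define w where
    "w = (\<lambda>k. v k - (\<beta> / t (k + 1)) *\<^sub>R (transpose B *v lb k + G2 (yb k)))"
  have v_rec: "v (k + 1) = prox (\<beta> / t (k + 1)) g1 (w k)"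
    and y_rec: "y (k + 1) = (1 / t (k + 1)) *\<^sub>R v (k + 1) + ((t (k + 1) - 1) / t (k + 1)) *\<^sub>R y k"
    and l_rec: "l (k + 1) = l k + (\<gamma> * t (k + 1)) *\<^sub>R (B *v v (k + 1) - b)"
    if "k \<ge> 1" for k
    using alg that unfolding accelerated_primal_dual_def Let_def w_def lb_def yb_def by blast+
  have t1: "t (k + 1) \<ge> 1" for k using t_ge by simp
  have tpos: "\<beta> / t (k + 1) > 0" for k using params t1[of k] by simp
  have vD: "v (k + 1) \<in> D" if "k \<ge> 1" for k
    unfolding v_rec[OF that] D_def by (rule prox_in_effective_domain[OF proper closed conv tpos])
  have yD: "y k \<in> D" if "k \<ge> 1" for k
    using that
  proof (induction k rule: dec_induct)
    case base
    then show ?case using y01 by simp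
  next
    case (step k)
    have "y (k + 1) = (1 - 1 / t (k + 1)) *\<^sub>R y k + (1 / t (k + 1)) *\<^sub>R v (k + 1)"
      unfolding y_rec[OF step.hyps(1)] using t1[of k] by (simp add: diff_divide_distrib)
    then show ?case
      using fconv[OF step.IH vD[OF step.hyps(1)], of "1 / t (k + 1)"] t1[of k] by simp
  qed
  \<comment> \<open>The momentum step is an average with \<open>v k\<close>, because the update of
    \<open>y\<close> expresses \<open>v k\<close> through \<open>y k\<close> and
    \<open>y (k - 1)\<close>. For \<open>k = 1\<close> both displacements vanish by the
    initialisation.\<close>
  have extrapolation: "yb k = y k + (1 / t (k + 1)) *\<^sub>R (v k - y k)" if "k \<ge> 1" for k
  proof -
    have "(t k - 1) *\<^sub>R (y k - y (k - 1)) = v k - y k"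
    proof (cases "k = 1")
      case True
      then show ?thesis using y01 by simp
    next
      case False
      define j where "j = k - 1"
      have j: "j \<ge> 1" "k = j + 1" using False that by (auto simp: j_def)
      have "t k *\<^sub>R y k = v k + (t k - 1) *\<^sub>R y j"
        using y_rec[OF j(1)] t1[of j] by (simp add: j(2) scaleR_right_distrib)
      then show ?thesis by (simp add: j(2) algebra_simps)
    qed
    then have "v k - y k = (t k - 1) *\<^sub>R (y k - y (k - 1))" by simp
    then show ?thesis by (simp add: yb_def)
  qed

  \<comment> \<open>The bound for \<open>t 1\<close> reads
    \<open>\<beta> * L \<le> (t 1)\<^sup>2 * (1 - \<beta> * K)\<close>. It forces the last factor to
    be nonnegative, so the bound survives when \<open>t 1\<close> grows to
    \<open>t k\<close>.\<close>
  have step_size: "\<beta> * (L + (t k)\<^sup>2 * \<gamma> * (onorm (\<lambda>x. B *v x))\<^sup>2) \<le> (t k)\<^sup>2" if "k \<ge> 1" for k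
  proof -
    define K where "K = \<gamma> * (onorm (\<lambda>x. B *v x))\<^sup>2"
    have "L \<ge> 0" "K \<ge> 0" using g2(3) params by (auto simp: K_def lipschitz_on_nonneg)
    have T: "(t 1)\<^sup>2 > 0" "(t 1)\<^sup>2 \<le> (t k)\<^sup>2"
      using t_ge[of 1] mono_onD[OF t_mono, of 1 k] that by (auto intro!: power_mono)
    have b1: "\<beta> * (L + (t 1)\<^sup>2 * K) \<le> (t 1)\<^sup>2"
    \<comment> \<open>A vanishing denominator, where the quotient is infinite, makes the product on
      the left vanish.\<close>
    proof (cases "L + (t 1)\<^sup>2 * K = 0")
      case False
      have "0 \<le> (t 1)\<^sup>2 * K" using \<open>K \<ge> 0\<close> by simp
      then have "L + (t 1)\<^sup>2 * K > 0" using False \<open>L \<ge> 0\<close> by linarith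
      moreover have "\<beta> \<le> (t 1)\<^sup>2 / (L + (t 1)\<^sup>2 * K)"
        using beta_le False by (simp add: K_def mult.assoc)
      ultimately show ?thesis by (simp add: pos_le_divide_eq)
    qed (use T in simp)
    have "0 \<le> \<beta> * L" using \<open>L \<ge> 0\<close> params by simp
    then have "0 \<le> (t 1)\<^sup>2 * (1 - \<beta> * K)"
      using b1 by (simp add: algebra_simps)
    then have "0 \<le> 1 - \<beta> * K" using T(1) by (simp add: zero_le_mult_iff)
    have "\<beta> * L \<le> (t 1)\<^sup>2 * (1 - \<beta> * K)" using b1 by (simp add: algebra_simps)
    also have "\<dots> \<le> (t k)\<^sup>2 * (1 - \<beta> * K)"
      using T(2) \<open>0 \<le> 1 - \<beta> * K\<close> by (rule mult_right_mono)
    finally show ?thesis by (simp add: K_def algebra_simps)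
  qed

  \<comment> \<open>The weight of the \<open>v\<close> term runs one index ahead, matching the
    \<open>t 2\<close> in \<open>E1\<close>; with \<open>v 1 = y 1\<close> the initial energy is
    \<open>E1\<close>.\<close>
  define E where "E = (\<lambda>k. (t k)\<^sup>2 * (d (y k) + ls \<bullet> (B *v y k - b))
      + (t (k + 1))\<^sup>2 / (2 * \<beta>) * (norm (v k - ys))\<^sup>2 + 1 / (2 * \<gamma>) * (norm (l k - ls))\<^sup>2)"
  have E_dec: "E (k + 1) \<le> E k" if k: "k \<ge> 1" for k
  proof -
    define \<tau> where "\<tau> = t (k + 1)"
    define \<xi> where "\<xi> = (1 / (\<beta> / \<tau>)) *\<^sub>R (w k - v (k + 1))"
    have \<tau>: "\<tau> \<ge> 1" using t1 by (simp add: \<tau>_def)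
    have "\<xi> \<in> subdifferential g1 (v (k + 1))"
      unfolding \<xi>_def \<tau>_def v_rec[OF k]
      by (rule prox_subgradient[OF proper closed conv tpos])
    then have sub: "f (v (k + 1)) + \<xi> \<bullet> (ys - v (k + 1)) + \<mu> / 2 * (norm (ys - v (k + 1)))\<^sup>2 \<le> f ys"
      by (rule strong)
    \<comment> \<open>Optimality of the proximal step, with the gradient of \<open>g2\<close>
      collected on the side where \<open>accelerated_primal_decrease\<close> has it.\<close>
    have \<xi>: "\<xi> + G2 (yb k) = (\<tau> / \<beta>) *\<^sub>R (v k - v (k + 1)) - transpose B *v lb k"
    proof -
      define q where "q = transpose B *v lb k + G2 (yb k)"
      have "w k = v k - (\<beta> / \<tau>) *\<^sub>R q"
        by (simp add: w_def \<tau>_def q_def)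
      then have "\<xi> = (\<tau> / \<beta>) *\<^sub>R (v k - v (k + 1)) - q"
        using params \<tau> by (simp add: \<xi>_def scaleR_right_diff_distrib)
      then show ?thesis by (simp add: q_def)
    qed
    have yb: "yb k = y k + (1 / \<tau>) *\<^sub>R (v k - y k)"
      using extrapolation[OF k] by (simp add: \<tau>_def)
    have yr: "y (k + 1) = (1 / \<tau>) *\<^sub>R v (k + 1) + ((\<tau> - 1) / \<tau>) *\<^sub>R y k"
      using y_rec[OF k] by (simp add: \<tau>_def)
    have primal: "\<tau>\<^sup>2 * d (y (k + 1)) \<le> (\<tau>\<^sup>2 - \<tau>) * d (y k)
        + \<tau> * (((\<tau> / \<beta>) *\<^sub>R (v k - v (k + 1)) - transpose B *v lb k) \<bullet> (v (k + 1) - ys))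
        - \<tau> * \<mu> / 2 * (norm (v (k + 1) - ys))\<^sup>2 + L / 2 * (norm (v (k + 1) - v k))\<^sup>2"
      unfolding \<xi>[symmetric] d_def
      by (rule accelerated_primal_decrease[where D = D and ?f1.0 = f,
            OF _ g2 yD[OF k] vD[OF k] \<tau> yb yr sub]) (use fconv in blast)
    show ?thesis
      unfolding E_def \<tau>_def[symmetric]
      using y_rec[OF k] l_rec[OF k] step_size[of "k + 1"] t_step1[OF k] t_step2[of "k + 1"]
      by (intro accelerated_energy_decrease[OF primal feas _ _ _ gap[OF yD[OF k]] \<tau> params])
         (auto simp: \<tau>_def lb_def)
  qed
  have E_le: "E k \<le> E1" if "k \<ge> 1" for k
    using that
  proof (induction k rule: dec_induct)
    case base
    have "real_of_ereal (g (y 1)) - real_of_ereal (g ys) = d (y 1)"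
      using gfin y01 ysD by (simp add: d_def)
    then show ?case using y01 by (simp add: E_def E1 numeral_2_eq_2)
  next
    case (step k)
    then show ?case using E_dec[of k] by simp
  qed
  \<comment> \<open>All three terms of the energy are nonnegative, so each alone is at most
    \<open>E1\<close>.\<close>
  have dual_le: "norm (l k - ls) \<le> sqrt (2 * \<gamma> * E1)"
    and gap_le: "(t k)\<^sup>2 * (d (y k) + ls \<bullet> (B *v y k - b)) \<le> E1" if "k \<ge> 1" for k
  proof -
    have "0 \<le> (t k)\<^sup>2 * (d (y k) + ls \<bullet> (B *v y k - b))"
      using gap[OF yD[OF that]] by simp
    moreover have "0 \<le> (t (k + 1))\<^sup>2 / (2 * \<beta>) * (norm (v k - ys))\<^sup>2" using params by simp
    moreover have "0 \<le> 1 / (2 * \<gamma>) * (norm (l k - ls))\<^sup>2" using params by simp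
    ultimately have "1 / (2 * \<gamma>) * (norm (l k - ls))\<^sup>2 \<le> E1"
      and gap': "(t k)\<^sup>2 * (d (y k) + ls \<bullet> (B *v y k - b)) \<le> E1"
      using E_le[OF that] by (auto simp: E_def)
    then have "(norm (l k - ls))\<^sup>2 \<le> 2 * \<gamma> * E1"
      using params by (simp add: field_simps)
    then show "norm (l k - ls) \<le> sqrt (2 * \<gamma> * E1)" by (rule real_le_rsqrt)
    show "(t k)\<^sup>2 * (d (y k) + ls \<bullet> (B *v y k - b)) \<le> E1" by (rule gap')
  qed
  have "0 \<le> E1"
  proof -
    have "0 \<le> (t 1)\<^sup>2 * (d (y 1) + ls \<bullet> (B *v y 1 - b))" using gap yD[of 1] by simp
    then show ?thesis using gap_le[of 1] by simp
  qed
  show ?thesis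
  proof (intro allI impI conjI)
    fix k :: nat assume k: "k \<ge> 1"
    have tk: "(t k)\<^sup>2 > 0" using t_ge[OF k] by simp
    have "(t k)\<^sup>2 * norm (B *v y k - b) \<le>
        2 * ((t 1)\<^sup>2 * norm (B *v y 1 - b) + (norm (l 1 - ls) + sqrt (2 * \<gamma> * E1)) / \<gamma>)"
      by (rule feasibility_rate[where t = t and v = v, OF t_ge t_step1 params(2) y_rec l_rec dual_le k])
    \<comment> \<open>The estimate has coefficient 2 at the initial residual where \<open>C4\<close>
      has 3.\<close>
    also have "\<dots> \<le> C4"
      by (simp add: C4 add_divide_distrib distrib_left)
    finally have res: "(t k)\<^sup>2 * norm (B *v y k - b) \<le> C4" .
    then show "norm (B *v y k - b) \<le> C4 / (t k)\<^sup>2"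
      using tk by (simp add: pos_le_divide_eq mult.commute)
    have "\<bar>ls \<bullet> (B *v y k - b)\<bar> \<le> norm ls * norm (B *v y k - b)"
      by (rule Cauchy_Schwarz_ineq2)
    then have "(t k)\<^sup>2 * \<bar>ls \<bullet> (B *v y k - b)\<bar> \<le> (t k)\<^sup>2 * (norm ls * norm (B *v y k - b))"
      by (rule mult_left_mono) simp
    also have "\<dots> = norm ls * ((t k)\<^sup>2 * norm (B *v y k - b))" by simp
    also have "\<dots> \<le> norm ls * C4" using res by (rule mult_left_mono) simp
    finally have "\<bar>(t k)\<^sup>2 * (ls \<bullet> (B *v y k - b))\<bar> \<le> norm ls * C4" by (simp add: abs_mult)
    \<comment> \<open>Nonnegativity of the gap bounds \<open>d (y k)\<close> from below and
      \<open>gap_le\<close> bounds it from above, each up to the multiplier term just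
      estimated.\<close>
    moreover have "0 \<le> (t k)\<^sup>2 * (d (y k) + ls \<bullet> (B *v y k - b))"
      using gap[OF yD[OF k]] by simp
    ultimately have "\<bar>(t k)\<^sup>2 * d (y k)\<bar> \<le> E1 + C4 * norm ls"
      using gap_le[OF k] \<open>0 \<le> E1\<close> by (simp add: distrib_left mult.commute abs_le_iff)
    then have "(t k)\<^sup>2 * \<bar>d (y k)\<bar> \<le> E1 + C4 * norm ls" by (simp add: abs_mult)
    then have "\<bar>d (y k)\<bar> \<le> (E1 + C4 * norm ls) / (t k)\<^sup>2"
      using tk by (simp add: pos_le_divide_eq mult.commute)
    then show "\<bar>g (y k) - g ys\<bar> \<le> ereal ((E1 + C4 * norm ls) / (t k)\<^sup>2)"
      using gfin[OF yD[OF k]] gfin[OF ysD] by (simp add: d_def)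
  qed
qed

end
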